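(* Let $A\in\mathbb{R}^{n\times n}$ be a group monotone matrix and let $A=K-L=U-V=X-Y$ be three proper G-weak regular splittings of type II of $A$, with $\mathcal{R}(K+X-A+YU^{\#}L)=\mathcal{R}(A)$ and $\mathcal{N}(K+X-A+YU^{\#}L)=\mathcal{N}(A)$. Let $\mathcal{H}=X^{\#}YU^{\#}VK^{\#}L$ and $\mathcal{S}=YX^{\#}VU^{\#}LK^{\#}$. Let $A=B-C$, $A=B_{12}-C_{12}$, $A=B_{13}-C_{13}$ and $A=B_{23}-C_{23}$ be proper G-weak regular splittings of type II induced by the matrices $\mathcal{S}$, $U^{\#}VK^{\#}L$, $X^{\#}YK^{\#}L$ and $X^{\#}YU^{\#}V$, respectively. If $B_{12}B^{\#}\ge I$, $B_{13}B^{\#}\ge I$ and $B_{23}B^{\#}\ge I$, then $$\rho(\mathcal{H})\le\min\{\rho(K^{\#}LU^{\#}V),\rho(X^{\#}YK^{\#}L),\rho(X^{\#}YU^{\#}V)\}<1.$$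
   Context: All matrices are real $n\times n$; $\mathcal{R}(\cdot)$, $\mathcal{N}(\cdot)$ denote range and null space; $\rho$ is the spectral radius; inequalities between matrices are entrywise. The group inverse of $A$, when it exists, is the unique matrix $A^{\#}$ with $AA^{\#}A=A$, $A^{\#}AA^{\#}=A^{\#}$, $AA^{\#}=A^{\#}A$; it exists iff $\mathrm{rank}(A)=\mathrm{rank}(A^2)$. $A$ is group monotone if $A^{\#}$ exists and $A^{\#}\ge 0$. An expression $A=U-V$ is a proper splitting of $A$ if $\mathcal{R}(U)=\mathcal{R}(A)$ and $\mathcal{N}(U)=\mathcal{N}(A)$. A proper splitting $A=U-V$ is a proper G-weak regular splitting of type II if $U^{\#}$ exists, $U^{\#}\ge 0$ and $VU^{\#}\ge 0$. The splitting $A=B-C$ induced by $\mathcal{S}$ is the proper splitting with $CB^{\#}=\mathcal{S}$, namely $B=(I-\mathcal{S})^{-1}A$. A proper splitting $A=B'-C'$ is induced by an iteration matrix $T$ (such as $U^{\#}VK^{\#}L$) if $(B')^{\#}C'=T$, i.e. $B'=A(I-T)^{-1}$. *)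

theory Defs
  imports "Jordan_Normal_Form.Spectral_Radius" "Jordan_Normal_Form.Matrix_Kernel"
begin

text \<open>
  Matrices are square of size \<open>n\<close>, i.e. elements of \<^term>\<open>carrier_mat n n\<close>.  The library order
  \<open>\<le>\<close> on matrices is the entrywise one, and \<^const>\<open>mat_kernel\<close> is the null space.
\<close>

definition mat_range :: "real mat \<Rightarrow> real vec set" where
  "mat_range A = {A *\<^sub>v x | x. x \<in> carrier_vec (dim_col A)}"

text \<open>The library spectral radius is defined for complex matrices; eigenvalues of a real matrix
  are taken over the complex numbers.\<close>

definition rho :: "real mat \<Rightarrow> real" where
  "rho T = spectral_radius (map_mat complex_of_real T)"

definition is_group_inverse :: "real mat \<Rightarrow> real mat \<Rightarrow> bool" where
  "is_group_inverse A G \<longleftrightarrow> G \<in> carrier_mat (dim_col A) (dim_row A) \<and>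
     A * G * A = A \<and> G * A * G = G \<and> A * G = G * A"

definition group_invertible :: "real mat \<Rightarrow> bool" where
  "group_invertible A \<longleftrightarrow> (\<exists>G. is_group_inverse A G)"

text \<open>Meaningful only for group invertible matrices; see \<open>is_group_inverse_unique\<close> below.\<close>

definition group_inverse :: "real mat \<Rightarrow> real mat" (\<open>_\<^sup>#\<close> [1000] 999) where
  "A\<^sup># = (THE G. is_group_inverse A G)"

definition group_monotone :: "real mat \<Rightarrow> bool" where
  "group_monotone A \<longleftrightarrow> group_invertible A \<and> 0\<^sub>m (dim_row A) (dim_col A) \<le> A\<^sup>#"

definition proper_splitting :: "nat \<Rightarrow> real mat \<Rightarrow> real mat \<Rightarrow> real mat \<Rightarrow> bool" where
  "proper_splitting n A U V \<longleftrightarrow>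
     A \<in> carrier_mat n n \<and> U \<in> carrier_mat n n \<and> V \<in> carrier_mat n n \<and> A = U - V \<and>
     mat_range U = mat_range A \<and> mat_kernel U = mat_kernel A"

definition proper_G_weak_regular_II :: "nat \<Rightarrow> real mat \<Rightarrow> real mat \<Rightarrow> real mat \<Rightarrow> bool" where
  "proper_G_weak_regular_II n A U V \<longleftrightarrow>
     proper_splitting n A U V \<and> group_invertible U \<and>
     0\<^sub>m n n \<le> U\<^sup># \<and> 0\<^sub>m n n \<le> V * U\<^sup>#"

text \<open>
  The two notions of an induced splitting.  That the inducing matrix determines the splitting,
  through \<open>B = (I - S)\<^sup>-\<^sup>1 A\<close> and \<open>B = A (I - T)\<^sup>-\<^sup>1\<close> respectively, is a consequence of the
  definitions: see \<open>induced_by_right\<close> and \<open>induced_by_iteration\<close> below.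
\<close>

definition splitting_induced_by_right ::
    "nat \<Rightarrow> real mat \<Rightarrow> real mat \<Rightarrow> real mat \<Rightarrow> real mat \<Rightarrow> bool" where
  "splitting_induced_by_right n A B C S \<longleftrightarrow>
     proper_splitting n A B C \<and> group_invertible B \<and> C * B\<^sup># = S"

definition splitting_induced_by_iteration ::
    "nat \<Rightarrow> real mat \<Rightarrow> real mat \<Rightarrow> real mat \<Rightarrow> real mat \<Rightarrow> bool" where
  "splitting_induced_by_iteration n A B C T \<longleftrightarrow>
     proper_splitting n A B C \<and> group_invertible B \<and> B\<^sup># * C = T"

lemma vec_eq_of_diff:
  fixes x y :: "real vec"
  assumes x: "x \<in> carrier_vec n" and y: "y \<in> carrier_vec n" and z: "x - y = 0\<^sub>v n"
  shows "x = y"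
proof (rule eq_vecI)
  fix i assume i: "i < dim_vec y"
  then have "(x - y) $ i = 0" using z y by simp
  then show "x $ i = y $ i" using i x y by simp
qed (use x y in auto)

lemma mat_eqI_vec:
  fixes M N :: "real mat"
  assumes M: "M \<in> carrier_mat n n" and N: "N \<in> carrier_mat n n"
    and eq: "\<And>v. v \<in> carrier_vec n \<Longrightarrow> M *\<^sub>v v = N *\<^sub>v v"
  shows "M = N"
proof (rule eq_matI)
  fix i j assume ij: "i < dim_row N" "j < dim_col N"
  have "(M *\<^sub>v unit_vec n j) $ i = (N *\<^sub>v unit_vec n j) $ i" using eq by simp
  then show "M $$ (i, j) = N $$ (i, j)"
    using M N ij by (simp add: scalar_prod_right_unit)
qed (use M N in auto)

lemma is_group_inverse_unique:
  assumes G: "is_group_inverse A G" and H: "is_group_inverse A H"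
  shows "G = H"
proof -
  define n where "n = dim_row A"
  have sq: "dim_col A = n"
    using G unfolding is_group_inverse_def n_def
    by (metis carrier_matD(2) index_mult_mat(2) index_mult_mat(3) carrier_matD(1))
  have A: "A \<in> carrier_mat n n" using sq by (auto simp: n_def)
  have Gc: "G \<in> carrier_mat n n" and Hc: "H \<in> carrier_mat n n"
    using G H A unfolding is_group_inverse_def by auto
  have g: "A * G * A = A" "G * A * G = G" "A * G = G * A"
    and h: "A * H * A = A" "H * A * H = H" "A * H = H * A"
    using G H unfolding is_group_inverse_def by blast+
  note as = assoc_mult_mat[of _ n n _ n _ n]
  have "A * G = (A * H * A) * G" by (simp only: h(1))
  also have "\<dots> = A * H * (A * G)" using A Gc Hc by (simp add: as)
  also have "\<dots> = H * A * (G * A)" by (simp only: g(3) h(3))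
  also have "\<dots> = H * (A * G * A)" using A Gc Hc by (simp add: as)
  also have "\<dots> = H * A" by (simp only: g(1))
  also have "\<dots> = A * H" by (simp only: h(3))
  finally have e: "A * G = A * H" .
  have "G = G * A * G" by (simp only: g(2))
  also have "\<dots> = G * (A * G)" using A Gc by (simp add: as)
  also have "\<dots> = G * A * H" unfolding e using A Gc Hc by (simp add: as)
  also have "\<dots> = H * A * H" using e g(3) h(3) by metis
  also have "\<dots> = H" by (rule h(2))
  finally show ?thesis .
qed

lemma group_inverse:
  assumes "group_invertible A"
  shows "is_group_inverse A (A\<^sup>#)"
  using assms unfolding group_invertible_def group_inverse_def
  by (metis is_group_inverse_unique theI)

lemma proper_splitting_projection:
  assumes sp: "proper_splitting n A B C" and gi: "group_invertible B"
  shows "C * (B\<^sup># * B) = C" and "B * B\<^sup># * C = C"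
proof -
  have A: "A \<in> carrier_mat n n" and B: "B \<in> carrier_mat n n" and C: "C \<in> carrier_mat n n"
    and AB: "A = B - C" and R: "mat_range B = mat_range A" and N: "mat_kernel B = mat_kernel A"
    using sp unfolding proper_splitting_def by auto
  have G: "B\<^sup># \<in> carrier_mat n n" and BGB: "B * B\<^sup># * B = B"
    using group_inverse[OF gi] B unfolding is_group_inverse_def by auto
  have Cv: "C *\<^sub>v v = B *\<^sub>v v - A *\<^sub>v v" if v: "v \<in> carrier_vec n" for v
  proof -
    have "A *\<^sub>v v = B *\<^sub>v v - C *\<^sub>v v"
      unfolding AB using B C v by (rule minus_mult_distrib_mat_vec)
    then show ?thesis using B C v by (intro eq_vecI) auto
  qed
  show "C * (B\<^sup># * B) = C"
  proof (rule mat_eqI_vec[of _ n])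
    fix e :: "real vec" assume e: "e \<in> carrier_vec n"
    let ?w = "(B\<^sup># * B) *\<^sub>v e"
    have w: "?w \<in> carrier_vec n" using G B e by auto
    have "B *\<^sub>v ?w = (B * (B\<^sup># * B)) *\<^sub>v e"
      using B G e by (simp add: assoc_mult_mat_vec[of _ n n _ n])
    also have "\<dots> = B *\<^sub>v e" using BGB B G by (simp add: assoc_mult_mat[of _ n n _ n _ n])
    finally have Bw: "B *\<^sub>v ?w = B *\<^sub>v e" .
    then have "?w - e \<in> mat_kernel B"
      unfolding mat_kernel_def using B e w by (simp add: mult_minus_distrib_mat_vec[of _ n n])
    then have "A *\<^sub>v (?w - e) = 0\<^sub>v n" using N A unfolding mat_kernel_def by auto
    then have "A *\<^sub>v ?w - A *\<^sub>v e = 0\<^sub>v n"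
      using A e w by (simp add: mult_minus_distrib_mat_vec[of _ n n])
    then have "A *\<^sub>v ?w = A *\<^sub>v e"
      by (rule vec_eq_of_diff[of _ n, rotated -1]) (use A e w in auto)
    then have "C *\<^sub>v ?w = C *\<^sub>v e" using Cv[OF e] Cv[OF w] Bw by simp
    then show "(C * (B\<^sup># * B)) *\<^sub>v e = C *\<^sub>v e"
      using assoc_mult_mat_vec[of C n n "B\<^sup># * B" n e] B C G e by auto
  qed (use B C G in auto)
  show "B * B\<^sup># * C = C"
  proof (rule mat_eqI_vec[of _ n])
    fix e :: "real vec" assume e: "e \<in> carrier_vec n"
    have "A *\<^sub>v e \<in> mat_range A" unfolding mat_range_def using A e by auto
    then have "A *\<^sub>v e \<in> mat_range B" using R by simp
    then obtain x where x: "x \<in> carrier_vec n" and Ax: "A *\<^sub>v e = B *\<^sub>v x"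
      unfolding mat_range_def using B by auto
    have Ce: "C *\<^sub>v e = B *\<^sub>v (e - x)"
      using Cv[OF e] Ax B e x by (simp add: mult_minus_distrib_mat_vec[of _ n n])
    have "(B * B\<^sup># * C) *\<^sub>v e = (B * B\<^sup>#) *\<^sub>v (C *\<^sub>v e)"
      using B C G e by (intro assoc_mult_mat_vec[of _ n n _ n]) auto
    also have "\<dots> = (B * B\<^sup># * B) *\<^sub>v (e - x)"
      unfolding Ce using B G e x by (intro assoc_mult_mat_vec[of _ n n _ n, symmetric]) auto
    also have "\<dots> = C *\<^sub>v e" by (simp only: Ce BGB)
    finally show "(B * B\<^sup># * C) *\<^sub>v e = C *\<^sub>v e" .
  qed (use B C G in auto)
qed

lemma invertible_mat_one_minus:
  fixes M :: "real mat"
  assumes M: "M \<in> carrier_mat n n"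
    and ker: "\<And>v. v \<in> carrier_vec n \<Longrightarrow> M *\<^sub>v v = v \<Longrightarrow> v = 0\<^sub>v n"
  shows "invertible_mat (1\<^sub>m n - M)"
proof -
  let ?D = "1\<^sub>m n - M"
  have D: "?D \<in> carrier_mat n n" using M by auto
  have "det ?D \<noteq> 0"
  proof
    assume "det ?D = 0"
    then obtain v where v: "v \<in> carrier_vec n" "v \<noteq> 0\<^sub>v n" and Dv: "?D *\<^sub>v v = 0\<^sub>v n"
      using det_0_iff_vec_prod_zero[OF D] by auto
    have z: "v - M *\<^sub>v v = 0\<^sub>v n"
      using Dv minus_mult_distrib_mat_vec[of "1\<^sub>m n" n n M v] M v by simp
    have "M *\<^sub>v v = v" using vec_eq_of_diff[OF v(1) _ z] M v by simp
    then show False using ker v by blast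
  qed
  then have "?D \<in> Units (ring_mat TYPE(real) n ())" by (rule det_non_zero_imp_unit[OF D])
  then obtain E where "E \<in> carrier_mat n n" "E * ?D = 1\<^sub>m n" "?D * E = 1\<^sub>m n"
    unfolding Units_def ring_mat_def by auto
  then show ?thesis using D unfolding invertible_mat_def inverts_mat_def
    by (metis carrier_matD square_mat.simps)
qed

lemma induced_by_right:
  assumes ind: "splitting_induced_by_right n A B C S"
  shows "invertible_mat (1\<^sub>m n - S)" and "(1\<^sub>m n - S) * B = A"
proof -
  have sp: "proper_splitting n A B C" and gi: "group_invertible B" and S: "S = C * B\<^sup>#"
    using ind unfolding splitting_induced_by_right_def by auto
  have A: "A \<in> carrier_mat n n" and B: "B \<in> carrier_mat n n" and C: "C \<in> carrier_mat n n"
    and AB: "A = B - C" and N: "mat_kernel B = mat_kernel A"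
    using sp unfolding proper_splitting_def by auto
  have G: "B\<^sup># \<in> carrier_mat n n"
    using group_inverse[OF gi] B unfolding is_group_inverse_def by auto
  have Sc: "S \<in> carrier_mat n n" using S C G by auto
  have "S * B = C * (B\<^sup># * B)" unfolding S using B C G by (intro assoc_mult_mat) auto
  then have SB: "S * B = C" using proper_splitting_projection(1)[OF sp gi] by simp
  show eq: "(1\<^sub>m n - S) * B = A"
    using minus_mult_distrib_mat[of "1\<^sub>m n" n n S B n] SB B Sc AB by simp
  show "invertible_mat (1\<^sub>m n - S)"
  proof (rule invertible_mat_one_minus[OF Sc])
    fix v :: "real vec" assume v: "v \<in> carrier_vec n" and Sv: "S *\<^sub>v v = v"
    have Cw: "C *\<^sub>v (B\<^sup># *\<^sub>v v) = v"
      using Sv v C G unfolding S by (simp add: assoc_mult_mat_vec[of _ n n _ n])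
    have "(B * B\<^sup>#) *\<^sub>v v = (B * B\<^sup># * C) *\<^sub>v (B\<^sup># *\<^sub>v v)"
      using assoc_mult_mat_vec[of "B * B\<^sup>#" n n C n "B\<^sup># *\<^sub>v v"] Cw B C G v by simp
    also have "\<dots> = v" using proper_splitting_projection(2)[OF sp gi] Cw by simp
    finally have Bw: "B *\<^sub>v (B\<^sup># *\<^sub>v v) = v"
      using B G v by (simp add: assoc_mult_mat_vec[of _ n n _ n])
    have "A *\<^sub>v (B\<^sup># *\<^sub>v v) = v - v"
      unfolding AB using minus_mult_distrib_mat_vec[of B n n C "B\<^sup># *\<^sub>v v"] Bw Cw B C G v by simp
    then have "B\<^sup># *\<^sub>v v \<in> mat_kernel A" unfolding mat_kernel_def using A G v by simp
    then have "B *\<^sub>v (B\<^sup># *\<^sub>v v) = 0\<^sub>v n" using N B unfolding mat_kernel_def by auto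
    then show "v = 0\<^sub>v n" using Bw by simp
  qed
qed

lemma induced_by_iteration:
  assumes ind: "splitting_induced_by_iteration n A B C T"
  shows "invertible_mat (1\<^sub>m n - T)" and "B * (1\<^sub>m n - T) = A"
proof -
  have sp: "proper_splitting n A B C" and gi: "group_invertible B" and T: "T = B\<^sup># * C"
    using ind unfolding splitting_induced_by_iteration_def by auto
  have A: "A \<in> carrier_mat n n" and B: "B \<in> carrier_mat n n" and C: "C \<in> carrier_mat n n"
    and AB: "A = B - C" and N: "mat_kernel B = mat_kernel A"
    using sp unfolding proper_splitting_def by auto
  have G: "B\<^sup># \<in> carrier_mat n n"
    using group_inverse[OF gi] B unfolding is_group_inverse_def by auto
  have Tc: "T \<in> carrier_mat n n" using T C G by auto
  have "B * T = B * B\<^sup># * C" unfolding T using B C G by (intro assoc_mult_mat[symmetric]) auto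
  then have BT: "B * T = C" using proper_splitting_projection(2)[OF sp gi] by simp
  show eq: "B * (1\<^sub>m n - T) = A"
    using mult_minus_distrib_mat[of B n n "1\<^sub>m n" n T] BT B Tc AB by simp
  show "invertible_mat (1\<^sub>m n - T)"
  proof (rule invertible_mat_one_minus[OF Tc])
    fix v :: "real vec" assume v: "v \<in> carrier_vec n" and Tv: "T *\<^sub>v v = v"
    have Bv: "B *\<^sub>v v = C *\<^sub>v v"
      using assoc_mult_mat_vec[of B n n T n v] BT Tv B Tc v by simp
    have "A *\<^sub>v v = C *\<^sub>v v - C *\<^sub>v v"
      unfolding AB using minus_mult_distrib_mat_vec[of B n n C v] Bv B C v by simp
    also have "\<dots> = 0\<^sub>v n" using C v by (intro minus_cancel_vec) auto
    finally have "v \<in> mat_kernel A" unfolding mat_kernel_def using A v by simp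
    then have "v \<in> mat_kernel B" using N by simp
    then have "C *\<^sub>v v = 0\<^sub>v n" using Bv B unfolding mat_kernel_def by auto
    moreover have "B\<^sup># *\<^sub>v (C *\<^sub>v v) = v"
      using Tv v C G unfolding T by (simp add: assoc_mult_mat_vec[of _ n n _ n])
    ultimately show "v = 0\<^sub>v n" using G by auto
  qed
qed

end

(*
  With P = A A# all products U U#, U# U of the proper splittings equal P, so A (U# V) = (V U#) A.
  Hence H = A# S A, and rho H = rho S.  It remains to compare S = C B# with S' = C' B'# for each of
  the two-term splittings.  Since A# S' = A# - B'#, a nonnegative vector u with S' u >= u satisfies
  B'# u <= 0, which forces u = 0; this gives rho S' < 1.  For rho S <= rho S' the positive row
  vectors w with w S' <= t w, which exist for every t > rho S', are carried over to S by means
  of B' B# >= 1; no Perron-Frobenius theorem is needed.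
*)
theory Submission
  imports Defs
begin

section \<open>Spectral radius of real matrices and of their products\<close>

lemma rho_attained:
  assumes M: "M \<in> carrier_mat n n" and n: "n > 0"
  obtains k v where "eigenvector (map_mat complex_of_real M) v k" "rho M = cmod k"
proof -
  have "map_mat complex_of_real M \<in> carrier_mat n n" using M by simp
  from spectral_radius_mem_max(1)[OF this n] that show ?thesis
    unfolding rho_def spectrum_def eigenvalue_def by auto
qed

lemma eigenvector_le_rho:
  assumes M: "M \<in> carrier_mat n n" and n: "n > 0"
    and k: "eigenvector (map_mat complex_of_real M) v k"
  shows "cmod k \<le> rho M"
proof -
  have "map_mat complex_of_real M \<in> carrier_mat n n" using M by simp
  from spectral_radius_mem_max(2)[OF this n, of "cmod k"] k show ?thesis
    unfolding rho_def spectrum_def eigenvalue_def by auto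
qed

lemma rho_nonneg:
  assumes "M \<in> carrier_mat n n" "n > 0"
  shows "0 \<le> rho M"
  using rho_attained[OF assms] by (metis norm_ge_zero)

text \<open>If v is a complex eigenvector of \<open>M * N\<close> for an eigenvalue k \<noteq> 0,
  then N v is nonzero and is an eigenvector of \<open>N * M\<close> for the same k. The eigenvalue 0
  is covered by the nonnegativity of the spectral radius.\<close>

lemma rho_mult_le:
  assumes M: "M \<in> carrier_mat n n" and N: "N \<in> carrier_mat n n" and n: "n > 0"
  shows "rho (M * N) \<le> rho (N * M)"
proof -
  have MN: "M * N \<in> carrier_mat n n" and NM: "N * M \<in> carrier_mat n n" using M N by auto
  obtain k v where kv: "eigenvector (map_mat complex_of_real (M * N)) v k"
    and r: "rho (M * N) = cmod k"
    using rho_attained[OF MN n] .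
  show ?thesis
  proof (cases "k = 0")
    case True
    then show ?thesis using r rho_nonneg[OF NM n] by simp
  next
    case False
    define M' where "M' = map_mat complex_of_real M"
    define N' where "N' = map_mat complex_of_real N"
    have M': "M' \<in> carrier_mat n n" and N': "N' \<in> carrier_mat n n"
      using M N by (auto simp: M'_def N'_def)
    have MN': "map_mat complex_of_real (M * N) = M' * N'"
      unfolding M'_def N'_def by (rule of_real_hom.mat_hom_mult[OF M N])
    have NM': "map_mat complex_of_real (N * M) = N' * M'"
      unfolding M'_def N'_def by (rule of_real_hom.mat_hom_mult[OF N M])
    have v: "v \<in> carrier_vec n" and v0: "v \<noteq> 0\<^sub>v n" and eq: "M' * N' *\<^sub>v v = k \<cdot>\<^sub>v v"
      using kv M' unfolding eigenvector_def MN' by auto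
    have eq': "M' *\<^sub>v (N' *\<^sub>v v) = k \<cdot>\<^sub>v v"
      using eq M' N' v by (simp add: assoc_mult_mat_vec[of _ n n _ n])
    have Nv: "N' *\<^sub>v v \<in> carrier_vec n" using N' v by auto
    have "N' *\<^sub>v v \<noteq> 0\<^sub>v n"
    proof
      assume "N' *\<^sub>v v = 0\<^sub>v n"
      then have "k \<cdot>\<^sub>v v = M' *\<^sub>v 0\<^sub>v n" using eq' by simp
      also have "\<dots> = 0\<^sub>v n" using M' by (intro eq_vecI) auto
      finally have "k \<cdot>\<^sub>v v = 0\<^sub>v n" .
      then have "v = 0\<^sub>v n" using v False by (auto simp: vec_eq_iff)
      then show False using v0 by simp
    qed
    moreover have "N' * M' *\<^sub>v (N' *\<^sub>v v) = k \<cdot>\<^sub>v (N' *\<^sub>v v)"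
      using assoc_mult_mat_vec[OF N' M' Nv] eq' mult_mat_vec[OF N' v] by simp
    ultimately have "eigenvector (map_mat complex_of_real (N * M)) (N' *\<^sub>v v) k"
      unfolding eigenvector_def NM' using Nv N' by simp
    then show ?thesis using eigenvector_le_rho[OF NM n] r by simp
  qed
qed

lemma rho_mult_commute:
  assumes "M \<in> carrier_mat n n" "N \<in> carrier_mat n n" "n > 0"
  shows "rho (M * N) = rho (N * M)"
  using rho_mult_le[OF assms] rho_mult_le[OF assms(2,1,3)] by simp

section \<open>Entrywise order and nonnegative matrices\<close>

lemma mat_mult_left_mono:
  fixes P Q R :: "real mat"
  assumes P: "P \<in> carrier_mat m n" and Q: "Q \<in> carrier_mat m n" and R: "R \<in> carrier_mat l m"
    and le: "P \<le> Q" and R0: "0\<^sub>m l m \<le> R"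
  shows "R * P \<le> R * Q"
  using P Q R le R0
  by (auto simp: less_eq_mat_def scalar_prod_def intro!: sum_mono mult_left_mono)

lemma mat_mult_right_mono:
  fixes P Q R :: "real mat"
  assumes P: "P \<in> carrier_mat l m" and Q: "Q \<in> carrier_mat l m" and R: "R \<in> carrier_mat m n"
    and le: "P \<le> Q" and R0: "0\<^sub>m m n \<le> R"
  shows "P * R \<le> Q * R"
  using P Q R le R0
  by (auto simp: less_eq_mat_def scalar_prod_def intro!: sum_mono mult_right_mono)

text \<open>The vector consists of the moduli of a complex eigenvector for an eigenvalue of maximal
  modulus; the inequality is the triangle inequality in each row. It is encoded as an n by 1 matrix
  so that the entrywise matrix order and the monotonicity of products apply to it.\<close>

lemma nonneg_mat_subeigenvector:
  assumes M: "M \<in> carrier_mat n n" and n: "n > 0" and M0: "0\<^sub>m n n \<le> M"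
  obtains u where "u \<in> carrier_mat n 1" "0\<^sub>m n 1 \<le> u" "u \<noteq> 0\<^sub>m n 1" "rho M \<cdot>\<^sub>m u \<le> M * u"
proof -
  let ?M = "map_mat complex_of_real M"
  obtain k v where kv: "eigenvector ?M v k" and r: "rho M = cmod k"
    using rho_attained[OF M n] .
  have v: "v \<in> carrier_vec n" and v0: "v \<noteq> 0\<^sub>v n" and eq: "?M *\<^sub>v v = k \<cdot>\<^sub>v v"
    using kv M unfolding eigenvector_def by auto
  define u where "u = mat n 1 (\<lambda>(i, _). cmod (v $ i))"
  have u: "u \<in> carrier_mat n 1" by (simp add: u_def)
  have "rho M \<cdot>\<^sub>m u \<le> M * u"
    unfolding less_eq_mat_def
  proof (intro conjI allI impI)
    fix i j assume i: "i < dim_row (M * u)" and j: "j < dim_col (M * u)"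
    have i: "i < n" and j: "j = 0" using i j M u by auto
    have "rho M * cmod (v $ i) = cmod ((?M *\<^sub>v v) $ i)"
      using r eq v i by (simp add: norm_mult)
    also have "(?M *\<^sub>v v) $ i = (\<Sum>l<n. complex_of_real (M $$ (i, l)) * v $ l)"
      using M v i by (simp add: scalar_prod_def atLeast0LessThan)
    also have "cmod \<dots> \<le> (\<Sum>l<n. M $$ (i, l) * cmod (v $ l))"
      using M M0 i by (intro sum_norm_le) (auto simp: norm_mult less_eq_mat_def)
    also have "\<dots> = (M * u) $$ (i, j)"
      using M i j by (simp add: u_def scalar_prod_def atLeast0LessThan)
    finally show "(rho M \<cdot>\<^sub>m u) $$ (i, j) \<le> (M * u) $$ (i, j)"
      using i j by (simp add: u_def)
  qed (use M u in auto)
  moreover have "u \<noteq> 0\<^sub>m n 1"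
  proof
    assume u0: "u = 0\<^sub>m n 1"
    have "v $ i = 0" if "i < n" for i
      using arg_cong[OF u0, of "\<lambda>x. x $$ (i, 0)"] that by (simp add: u_def)
    then have "v = 0\<^sub>v n" using v by (intro eq_vecI) auto
    then show False using v0 by simp
  qed
  moreover have "0\<^sub>m n 1 \<le> u" by (simp add: u_def less_eq_mat_def)
  ultimately show ?thesis using that[OF u] by blast
qed

text \<open>With r = \<open>rho M\<close> and u a nonnegative vector such that r u \<le> M u, one
  gets r (w M u) \<le> w M M u \<le> t (w M u), and the scalar w M u cancels once it is positive.
  The bound is assumed for the row \<open>w * M\<close> because the comparison of two splittings
  delivers it in that form.\<close>

lemma rho_le_of_positive_row:
  assumes M: "M \<in> carrier_mat n n" and n: "n > 0" and M0: "0\<^sub>m n n \<le> M"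
    and w: "w \<in> carrier_mat 1 n" and w0: "\<And>j. j < n \<Longrightarrow> 0 < w $$ (0, j)"
    and le: "w * M * M \<le> t \<cdot>\<^sub>m (w * M)" and t: "0 \<le> t"
  shows "rho M \<le> t"
proof (cases "rho M = 0")
  case False
  then have r: "0 < rho M" using rho_nonneg[OF M n] by simp
  obtain u where u: "u \<in> carrier_mat n 1" and u0: "0\<^sub>m n 1 \<le> u" and un: "u \<noteq> 0\<^sub>m n 1"
    and Mu: "rho M \<cdot>\<^sub>m u \<le> M * u"
    using nonneg_mat_subeigenvector[OF M n M0] .
  have wn: "0\<^sub>m 1 n \<le> w" using w w0 by (force simp: less_eq_mat_def)
  have wM: "w * M \<in> carrier_mat 1 n" and Muc: "M * u \<in> carrier_mat n 1"
    using w M u by auto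
  have as: "w * M * u = w * (M * u)" by (rule assoc_mult_mat[OF w M u])
  obtain i where i: "i < n" "u $$ (i, 0) \<noteq> 0"
    using un u by (metis (no_types, opaque_lifting) carrier_matD eq_matI index_zero_mat less_one)
  have un0: "0 \<le> u $$ (l, 0)" if "l < n" for l using u0 u that by (simp add: less_eq_mat_def)
  have "(w * u) $$ (0, 0) = (\<Sum>l<n. w $$ (0, l) * u $$ (l, 0))"
    using w u by (simp add: scalar_prod_def atLeast0LessThan)
  also have "\<dots> > 0"
    using i un0[OF i(1)] w0 un0
    by (intro sum_pos2[of _ i] mult_pos_pos mult_nonneg_nonneg) (auto simp: less_imp_le less_le)
  finally have pos: "0 < (w * u) $$ (0, 0)" .
  \<comment> \<open>The row \<open>w * M\<close> may have zero entries, so the positivity of w M u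
    is derived from w M u \<ge> r (w u) > 0.\<close>
  have "rho M \<cdot>\<^sub>m (w * u) \<le> w * M * u"
    using mat_mult_left_mono[OF _ Muc w Mu wn] u w as by (simp add: mult_smult_distrib)
  then have "rho M * (w * u) $$ (0, 0) \<le> (w * M * u) $$ (0, 0)"
    using w u by (auto simp: less_eq_mat_def simp del: index_mult_mat(1))
  then have a: "0 < (w * M * u) $$ (0, 0)"
    using mult_pos_pos[OF r pos] by linarith
  have wM0: "0\<^sub>m 1 n \<le> w * M"
    using mat_mult_left_mono[OF _ M w M0 wn] w by simp
  have "rho M \<cdot>\<^sub>m (w * M * u) \<le> w * M * (M * u)"
    using mat_mult_left_mono[OF _ Muc wM Mu wM0] u wM by (simp add: mult_smult_distrib)
  also have "\<dots> = w * M * M * u"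
    by (rule assoc_mult_mat[OF wM M u, symmetric])
  also have "\<dots> \<le> t \<cdot>\<^sub>m (w * M) * u"
    by (rule mat_mult_right_mono[where l = 1, OF _ _ u le u0]) (use wM M in auto)
  also have "\<dots> = t \<cdot>\<^sub>m (w * M * u)" by (rule mult_smult_assoc_mat[OF wM u])
  finally have "rho M * (w * M * u) $$ (0, 0) \<le> t * (w * M * u) $$ (0, 0)"
    using w u by (auto simp: less_eq_mat_def simp del: index_mult_mat(1))
  then show ?thesis using a by simp
qed (use t in simp)

section \<open>Growth of powers and positive subinvariant rows\<close>

lemma pow_smult_mat:
  fixes A :: "'a :: comm_ring_1 mat"
  assumes A: "A \<in> carrier_mat n n"
  shows "(c \<cdot>\<^sub>m A) ^\<^sub>m k = c ^ k \<cdot>\<^sub>m (A ^\<^sub>m k)"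
proof (induct k)
  case 0
  show ?case using A by (intro eq_matI) auto
next
  case (Suc k)
  have P: "A ^\<^sub>m k \<in> carrier_mat n n" using A by simp
  have "(c \<cdot>\<^sub>m A) ^\<^sub>m Suc k = c ^ k \<cdot>\<^sub>m (A ^\<^sub>m k) * (c \<cdot>\<^sub>m A)" using Suc by simp
  also have "\<dots> = c ^ k \<cdot>\<^sub>m (c \<cdot>\<^sub>m (A ^\<^sub>m k * A))"
    using mult_smult_assoc_mat[OF P, of "c \<cdot>\<^sub>m A" n] mult_smult_distrib[OF P A] A by simp
  also have "\<dots> = c ^ Suc k \<cdot>\<^sub>m (A ^\<^sub>m Suc k)"
    by (intro eq_matI) (auto simp: ac_simps)
  finally show ?case .
qed

text \<open>The matrix A / s has spectral radius below 1, so its Jordan normal form bounds the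
  entries of all its powers by one constant; scaling back gives the factor
  \<open>s ^ k\<close>.\<close>

lemma spectral_radius_pow_bound:
  assumes A: "A \<in> carrier_mat n n" and n: "n > 0" and s: "spectral_radius A < s"
  obtains c where "\<And>k i j. i < n \<Longrightarrow> j < n \<Longrightarrow> cmod ((A ^\<^sub>m k) $$ (i, j)) \<le> c * s ^ k"
proof -
  have s0: "0 < s"
    using s spectral_radius_mem_max(1)[OF A n] by (metis imageE le_less_trans norm_ge_zero)
  define A' where "A' = complex_of_real (1 / s) \<cdot>\<^sub>m A"
  have A': "A' \<in> carrier_mat n n" using A by (simp add: A'_def)
  obtain k where k: "k \<in> spectrum A'" and r: "spectral_radius A' = cmod k"
    using spectral_radius_mem_max(1)[OF A' n] by auto
  obtain v where v: "v \<in> carrier_vec n" "v \<noteq> 0\<^sub>v n" and eq: "A' *\<^sub>v v = k \<cdot>\<^sub>v v"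
    using k A' unfolding spectrum_def eigenvalue_def eigenvector_def by auto
  have "A *\<^sub>v v = (of_real s * k) \<cdot>\<^sub>v v"
  proof (rule eq_vecI)
    fix i assume i: "i < dim_vec ((of_real s * k) \<cdot>\<^sub>v v)"
    have "(A' *\<^sub>v v) $ i = (k \<cdot>\<^sub>v v) $ i" by (simp only: eq)
    then have "of_real (1 / s) * (A *\<^sub>v v) $ i = k * v $ i"
      using i v A unfolding A'_def by (simp add: scalar_prod_def sum_distrib_left ac_simps)
    then show "(A *\<^sub>v v) $ i = ((of_real s * k) \<cdot>\<^sub>v v) $ i"
      using i v s0 by (simp add: field_simps)
  qed (use A v in auto)
  then have "of_real s * k \<in> spectrum A"
    using v A unfolding spectrum_def eigenvalue_def eigenvector_def by auto
  then have "cmod (of_real s * k) \<le> spectral_radius A"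
    using spectral_radius_mem_max(2)[OF A n] by blast
  then have "s * cmod k \<le> spectral_radius A" using s0 by (simp add: norm_mult)
  then have "s * cmod k < s * 1" using s by linarith
  then have "spectral_radius A' < 1" using s0 r by simp
  then obtain c where c: "\<And>k. norm_bound (A' ^\<^sub>m k) c"
    using spectral_radius_jnf_norm_bound_less_1_upper_triangular[OF A'] by blast
  have "cmod ((A ^\<^sub>m k) $$ (i, j)) \<le> c * s ^ k" if "i < n" "j < n" for k i j
  proof -
    have "cmod ((A' ^\<^sub>m k) $$ (i, j)) \<le> c"
      using c[of k] A' that unfolding norm_bound_def by simp
    moreover have "(A' ^\<^sub>m k) $$ (i, j) = complex_of_real (1 / s) ^ k * (A ^\<^sub>m k) $$ (i, j)"
      unfolding A'_def pow_smult_mat[OF A] using A that by simp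
    ultimately show ?thesis using s0
      by (simp add: norm_mult norm_power norm_divide field_simps)
  qed
  then show ?thesis using that by blast
qed

text \<open>The row vector is a partial sum of the Neumann series \<open>\<Sum>k. e\<^sup>T (M/t)\<^sup>k\<close> with \<open>e\<close>
  the all-ones vector, cut off where \<open>e\<^sup>T (M/t)\<^sup>k \<le> e\<^sup>T\<close>.\<close>

lemma positive_subinvariant_row:
  assumes M: "M \<in> carrier_mat n n" and n: "n > 0" and M0: "0\<^sub>m n n \<le> M" and t: "rho M < t"
  obtains w where "w \<in> carrier_mat 1 n" "\<And>j. j < n \<Longrightarrow> 0 < w $$ (0, j)" "w * M \<le> t \<cdot>\<^sub>m w"
proof -
  \<comment> \<open>The gap between s and t makes (s / t)^k tend to 0, which beats every constant
    factor in the bound on the powers.\<close>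
  obtain s where s: "rho M < s" "s < t" using t dense by blast
  have s0: "0 < s" using s rho_nonneg[OF M n] by simp
  have t0: "0 < t" using s s0 by simp
  have Mc: "map_mat complex_of_real M \<in> carrier_mat n n" using M by simp
  obtain c where c: "\<And>k i j. i < n \<Longrightarrow> j < n \<Longrightarrow>
      cmod ((map_mat complex_of_real M ^\<^sub>m k) $$ (i, j)) \<le> c * s ^ k"
    using spectral_radius_pow_bound[OF Mc n, of s] s(1) unfolding rho_def by blast
  have bound: "(M ^\<^sub>m k) $$ (i, j) \<le> c * s ^ k" if "i < n" "j < n" for k i j
    using c[OF that, of k] that M
    by (simp add: of_real_hom.mat_hom_pow[OF M, symmetric])
  have P0: "0\<^sub>m n n \<le> M ^\<^sub>m k" for k
  proof (induct k)
    case (Suc k)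
    have "0\<^sub>m n n * M \<le> M ^\<^sub>m k * M"
      by (rule mat_mult_right_mono[OF _ _ M Suc M0]) (use M in auto)
    then show ?case using M by simp
  qed (use M in \<open>auto simp: less_eq_mat_def\<close>)
  \<comment> \<open>The number \<open>e k j\<close> is the j-th column sum of (M / t)^k, an entry of
    the k-th Neumann term.\<close>
  define e where "e k j = (\<Sum>i<n. (M ^\<^sub>m k) $$ (i, j)) / t ^ k" for k j
  have e_nonneg: "0 \<le> e k j" if "j < n" for k j
    unfolding e_def using P0[of k] M t0 that
    by (intro divide_nonneg_nonneg sum_nonneg) (auto simp: less_eq_mat_def)
  have e0: "e 0 j = 1" if "j < n" for j
    using that M by (simp add: e_def sum.delta)
  \<comment> \<open>Multiplication by \<open>M\<close> turns each Neumann term into t times the next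
    one.\<close>
  have step: "(\<Sum>l<n. e k l * M $$ (l, j)) = t * e (Suc k) j" if j: "j < n" for k j
  proof -
    have "(\<Sum>l<n. e k l * M $$ (l, j)) = (\<Sum>l<n. \<Sum>i<n. (M ^\<^sub>m k) $$ (i, l) * M $$ (l, j)) / t ^ k"
      by (simp add: e_def sum_distrib_right sum_divide_distrib)
    also have "(\<Sum>l<n. \<Sum>i<n. (M ^\<^sub>m k) $$ (i, l) * M $$ (l, j)) =
        (\<Sum>i<n. \<Sum>l<n. (M ^\<^sub>m k) $$ (i, l) * M $$ (l, j))"
      by (rule sum.swap)
    also have "\<dots> = (\<Sum>i<n. (M ^\<^sub>m Suc k) $$ (i, j))"
      using M j by (intro sum.cong) (auto simp: scalar_prod_def atLeast0LessThan)
    finally show ?thesis using t0 by (simp add: e_def)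
  qed
  have "(\<lambda>k. (real n * c) * (s / t) ^ k) \<longlonglongrightarrow> (real n * c) * 0"
    using s s0 by (intro tendsto_mult LIMSEQ_power_zero tendsto_const) auto
  then have "eventually (\<lambda>k. (real n * c) * (s / t) ^ k < 1) sequentially"
    by (intro order_tendstoD(2)) auto
  \<comment> \<open>With \<open>N > 0\<close> the partial sum contains the term k = 0, whose entries
    are all 1; this makes \<open>w\<close> strictly positive.\<close>
  then obtain N where N: "real n * c * (s / t) ^ N < 1" "N > 0"
    unfolding eventually_sequentially by (metis le_add1 le_add2 less_eq_Suc_le plus_1_eq_Suc)
  have eN: "e N j \<le> 1" if "j < n" for j
  proof -
    have "e N j \<le> (\<Sum>i<n. c * s ^ N) / t ^ N"
      unfolding e_def using bound that t0 by (intro divide_right_mono sum_mono) auto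
    also have "\<dots> = real n * c * (s / t) ^ N" by (simp add: power_divide)
    finally show ?thesis using N(1) by simp
  qed
  define w where "w = mat 1 n (\<lambda>(_, j). \<Sum>k<N. e k j)"
  have w: "w \<in> carrier_mat 1 n" by (simp add: w_def)
  have "0 < w $$ (0, j)" if j: "j < n" for j
  proof -
    have "e 0 j \<le> (\<Sum>k<N. e k j)" using e_nonneg[OF j] N(2) by (intro member_le_sum) auto
    then show ?thesis using e0[OF j] j by (simp add: w_def)
  qed
  moreover have "w * M \<le> t \<cdot>\<^sub>m w"
    unfolding less_eq_mat_def
  proof (intro conjI allI impI)
    fix i j assume "i < dim_row (t \<cdot>\<^sub>m w)" "j < dim_col (t \<cdot>\<^sub>m w)"
    then have i: "i = 0" and j: "j < n" using w by auto
    have "(w * M) $$ (i, j) = (\<Sum>l<n. \<Sum>k<N. e k l * M $$ (l, j))"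
      using i j M by (simp add: w_def scalar_prod_def atLeast0LessThan sum_distrib_right)
    also have "\<dots> = (\<Sum>k<N. \<Sum>l<n. e k l * M $$ (l, j))" by (rule sum.swap)
    also have "\<dots> = t * (\<Sum>k<N. e (Suc k) j)" using j by (simp add: step sum_distrib_left)
    \<comment> \<open>The shift of the index trades \<open>e 0 j\<close> = 1 for
      \<open>e N j\<close> \<le> 1, so the sum does not grow.\<close>
    also have "(\<Sum>k<N. e (Suc k) j) = (\<Sum>k<N. e k j) + e N j - e 0 j"
      using sum.lessThan_Suc[of "\<lambda>k. e k j" N] sum.lessThan_Suc_shift[of "\<lambda>k. e k j" N] by simp
    also have "t * \<dots> \<le> t * (\<Sum>k<N. e k j)"
      using e0[OF j] eN[OF j] t0 by (intro mult_left_mono) auto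
    finally show "(w * M) $$ (i, j) \<le> (t \<cdot>\<^sub>m w) $$ (i, j)" using i j by (simp add: w_def)
  qed (use M w in auto)
  ultimately show ?thesis using that[OF w] by blast
qed

section \<open>Projections attached to proper splittings\<close>

lemma group_inverse_facts:
  assumes "group_invertible B" "B \<in> carrier_mat n n"
  shows "B\<^sup># \<in> carrier_mat n n" "B * B\<^sup># * B = B" "B\<^sup># * B * B\<^sup># = B\<^sup>#" "B * B\<^sup># = B\<^sup># * B"
  using group_inverse[OF assms(1)] assms(2) unfolding is_group_inverse_def by auto

text \<open>Both products are the projection onto the common range along the common null space.
  Algebraically, \<open>proper_splitting_projection\<close> is used twice: for A = U - V and for U =
  A - (-V), which is a proper splitting of U.\<close>

lemma proper_splitting_same_projection:
  assumes sp: "proper_splitting n A U V" and A: "group_invertible A" and U: "group_invertible U"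
  shows "U * U\<^sup># = A * A\<^sup>#"
proof -
  have Ac: "A \<in> carrier_mat n n" and Uc: "U \<in> carrier_mat n n" and Vc: "V \<in> carrier_mat n n"
    and AUV: "A = U - V"
    using sp unfolding proper_splitting_def by auto
  note a = group_inverse_facts[OF A Ac] and u = group_inverse_facts[OF U Uc]
  have UAV: "U = A - (- V)" and UAV': "U = A + V" unfolding AUV using Uc Vc by (auto intro!: eq_matI)
  have Vn: "- V \<in> carrier_mat n n" using Vc by simp
  have sp': "proper_splitting n U A (- V)"
    using sp UAV Vn unfolding proper_splitting_def by auto
  have "- V * (A\<^sup># * A) = - V" by (rule proper_splitting_projection(1)[OF sp' A])
  then have V: "V * (A\<^sup># * A) = V" using Vc a(1) Ac by simp
  have "U * (A\<^sup># * A) = A * (A\<^sup># * A) + V * (A\<^sup># * A)"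
    unfolding UAV' by (rule add_mult_distrib_mat) (use Ac Vc a(1) in auto)
  also have "A * (A\<^sup># * A) = A" using a(1,2) Ac by (simp add: assoc_mult_mat[of _ n n _ n _ n])
  finally have UP: "U * (A\<^sup># * A) = U" using V UAV' by simp
  have "U * U\<^sup># * A = U * U\<^sup># * U - U * U\<^sup># * V"
    unfolding AUV by (rule mult_minus_distrib_mat) (use Uc Vc u(1) in auto)
  then have PA: "U * U\<^sup># * A = A"
    using u(2) proper_splitting_projection(2)[OF sp U] AUV by simp
  \<comment> \<open>Put P = A# A and Q = U U#. From U P = U follows Q P = Q, and from Q A = A
    follows Q P = P.\<close>
  have "U * U\<^sup># = U\<^sup># * (U * (A\<^sup># * A))" using UP u(4) by simp
  also have "\<dots> = U * U\<^sup># * (A\<^sup># * A)"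
    unfolding u(4) using u(1) a(1) Uc Ac by (simp add: assoc_mult_mat[of _ n n _ n _ n])
  also have "\<dots> = U * U\<^sup># * A * A\<^sup>#"
    unfolding a(4)[symmetric] using u(1) a(1) Uc Ac by (simp add: assoc_mult_mat[of _ n n _ n _ n])
  finally show "U * U\<^sup># = A * A\<^sup>#" using PA by simp
qed

section \<open>Spectral radii of type II splittings\<close>

text \<open>Otherwise u \<le> S u for some nonzero u \<ge> 0, where S = C B#. Then A# u \<le> A# S u
  = A# u - B# u, so B# u \<le> 0. Together with B# \<ge> 0 this gives B# u = 0, hence S u = C (B# u)
  = 0 and u = 0.\<close>

lemma type_II_rho_less_1:
  assumes n: "n > 0" and A: "group_monotone A" and s: "proper_G_weak_regular_II n A B C"
  shows "rho (C * B\<^sup>#) < 1"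
proof (rule ccontr)
  let ?S = "C * B\<^sup>#"
  assume "\<not> ?thesis"
  then have ge: "1 \<le> rho ?S" by simp
  have sp: "proper_splitting n A B C" and B: "group_invertible B"
    and B0: "0\<^sub>m n n \<le> B\<^sup>#" and S0: "0\<^sub>m n n \<le> ?S"
    using s unfolding proper_G_weak_regular_II_def by auto
  have Ac: "A \<in> carrier_mat n n" and Bc: "B \<in> carrier_mat n n" and Cc: "C \<in> carrier_mat n n"
    and ABC: "A = B - C"
    using sp unfolding proper_splitting_def by auto
  have Ai: "group_invertible A" and A0: "0\<^sub>m n n \<le> A\<^sup>#" using A Ac unfolding group_monotone_def by auto
  note a = group_inverse_facts[OF Ai Ac] and b = group_inverse_facts[OF B Bc]
  have Sc: "?S \<in> carrier_mat n n" using Cc b(1) by simp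
  obtain u where u: "u \<in> carrier_mat n 1" "0\<^sub>m n 1 \<le> u" "u \<noteq> 0\<^sub>m n 1" "rho ?S \<cdot>\<^sub>m u \<le> ?S * u"
    using nonneg_mat_subeigenvector[OF Sc n S0] .
  have le: "u \<le> ?S * u"
  proof -
    have "u \<le> rho ?S \<cdot>\<^sub>m u"
      using u(1,2) ge mult_right_mono[OF ge] by (auto simp: less_eq_mat_def)
    then show ?thesis using u(4) by (rule order_trans)
  qed
  have "A * B\<^sup># = B * B\<^sup># - ?S"
    unfolding ABC by (rule minus_mult_distrib_mat) (use Bc Cc b(1) in auto)
  \<comment> \<open>Here B B# is replaced by the common projection A A#, which A# absorbs in the
    product A# S.\<close>
  then have S: "?S = A * A\<^sup># - A * B\<^sup>#"
    using proper_splitting_same_projection[OF sp Ai B] Sc Ac a(1) b(1) Bc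
    by (auto simp: mat_eq_iff)
  have AAB: "A\<^sup># * (A * B\<^sup>#) = B\<^sup>#"
  proof -
    have "A\<^sup># * (A * B\<^sup>#) = A * A\<^sup># * B\<^sup>#"
      unfolding a(4) using a(1) b(1) Ac by (simp add: assoc_mult_mat[of _ n n _ n _ n])
    also have "\<dots> = B\<^sup># * B * B\<^sup>#"
      using proper_splitting_same_projection[OF sp Ai B] b(4) by simp
    finally show ?thesis using b(3) by simp
  qed
  have "A\<^sup># * ?S = A\<^sup># * (A * A\<^sup>#) - A\<^sup># * (A * B\<^sup>#)"
    unfolding S by (rule mult_minus_distrib_mat) (use a(1) b(1) Ac in auto)
  then have AS: "A\<^sup># * ?S = A\<^sup># - B\<^sup>#"
    using AAB a(3) a(1) Ac by (simp add: assoc_mult_mat[of _ n n _ n _ n])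
  have "A\<^sup># * u \<le> A\<^sup># * (?S * u)"
    by (rule mat_mult_left_mono[OF u(1) _ a(1) le A0]) (use Sc u(1) in auto)
  also have "\<dots> = (A\<^sup># - B\<^sup>#) * u"
    using assoc_mult_mat[OF a(1) Sc u(1)] AS by simp
  also have "\<dots> = A\<^sup># * u - B\<^sup># * u"
    by (rule minus_mult_distrib_mat[OF a(1) b(1) u(1)])
  finally have "B\<^sup># * u \<le> 0\<^sub>m n 1"
    using a(1) b(1) u(1) by (auto simp: less_eq_mat_def simp del: index_mult_mat(1))
  moreover have "0\<^sub>m n 1 \<le> B\<^sup># * u"
    using mat_mult_left_mono[OF zero_carrier_mat u(1) b(1) u(2) B0] b(1) by simp
  ultimately have "B\<^sup># * u = 0\<^sub>m n 1" by (rule order.antisym)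
  then have "?S * u = 0\<^sub>m n 1"
    using assoc_mult_mat[OF Cc b(1) u(1)] Cc by simp
  then show False using le u(2,3) by (metis order.antisym)
qed

text \<open>If \<open>w\<close> is a positive row with \<open>w S' \<le> t w\<close>, \<open>S' = C' B'\<^sup>#\<close> and \<open>S = C B\<^sup>#\<close>, then
  multiplying \<open>1 \<le> B' B\<^sup>#\<close> by \<open>w (1 - S') \<ge> (1 - t) w\<close> gives \<open>(1 - t) w \<le> w A B\<^sup>#\<close>, because
  \<open>(1 - S') B' = A\<close>.  As \<open>A B\<^sup># S = S - S S\<close>, multiplying by \<open>S\<close> turns this into
  \<open>w S S \<le> t w S\<close>.\<close>

lemma type_II_rho_comparison:
  assumes n: "n > 0" and s: "proper_G_weak_regular_II n A B C"
    and s': "proper_G_weak_regular_II n A B' C'"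
    and le: "1\<^sub>m n \<le> B' * B\<^sup>#" and r1: "rho (C' * B'\<^sup>#) < 1"
  shows "rho (C * B\<^sup>#) \<le> rho (C' * B'\<^sup>#)"
proof (rule ccontr)
  let ?S = "C * B\<^sup>#" and ?S' = "C' * B'\<^sup>#"
  assume "\<not> ?thesis"
  \<comment> \<open>The choice t < 1 keeps the factor 1 - t positive, and with it the row
    \<open>y\<close> below nonnegative.\<close>
  then obtain t where t: "rho ?S' < t" "t < rho ?S" "t < 1"
    using dense[of "rho ?S'" "min (rho ?S) 1"] r1 by auto
  have sp: "proper_splitting n A B C" and B: "group_invertible B" and S0: "0\<^sub>m n n \<le> ?S"
    using s unfolding proper_G_weak_regular_II_def by auto
  have sp': "proper_splitting n A B' C'" and B': "group_invertible B'" and S0': "0\<^sub>m n n \<le> ?S'"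
    using s' unfolding proper_G_weak_regular_II_def by auto
  have Ac: "A \<in> carrier_mat n n" and Bc: "B \<in> carrier_mat n n" and Cc: "C \<in> carrier_mat n n"
    and ABC: "A = B - C"
    using sp unfolding proper_splitting_def by auto
  have Bc': "B' \<in> carrier_mat n n" and Cc': "C' \<in> carrier_mat n n"
    using sp' unfolding proper_splitting_def by auto
  note b = group_inverse_facts[OF B Bc] and b' = group_inverse_facts[OF B' Bc']
  have Sc: "?S \<in> carrier_mat n n" and Sc': "?S' \<in> carrier_mat n n"
    using Cc b(1) Cc' b'(1) by auto
  obtain w where w: "w \<in> carrier_mat 1 n" "\<And>j. j < n \<Longrightarrow> 0 < w $$ (0, j)" "w * ?S' \<le> t \<cdot>\<^sub>m w"
    using positive_subinvariant_row[OF Sc' n S0' t(1)] by blast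
  define y where "y = w * (1\<^sub>m n - ?S')"
  have yc: "y \<in> carrier_mat 1 n" using w(1) Sc' by (simp add: y_def minus_carrier_mat)
  have "y = w - w * ?S'"
    unfolding y_def using mult_minus_distrib_mat[OF w(1) one_carrier_mat Sc'] w(1) by simp
  then have wy: "(1 - t) \<cdot>\<^sub>m w \<le> y"
    using w(1,3) Sc' by (auto simp: less_eq_mat_def algebra_simps simp del: index_mult_mat(1))
  have y0: "0\<^sub>m 1 n \<le> y"
  proof -
    have "0\<^sub>m 1 n \<le> (1 - t) \<cdot>\<^sub>m w"
      using w(1,2) t(3) by (auto simp: less_eq_mat_def less_imp_le)
    then show ?thesis using wy by (rule order_trans)
  qed
  have SB': "(1\<^sub>m n - ?S') * B' = A"
    using sp' B' by (intro induced_by_right(2)[of n A B' C']) (simp add: splitting_induced_by_right_def)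
  have yB: "y * B' = w * A"
    unfolding y_def using SB' assoc_mult_mat[OF w(1) _ Bc', of "1\<^sub>m n - ?S'"] Sc'
    by (simp add: minus_carrier_mat)
  have AB: "A * B\<^sup># \<in> carrier_mat n n" using Ac b(1) by simp
  have "(1 - t) \<cdot>\<^sub>m w \<le> y * 1\<^sub>m n" using wy yc by simp
  also have "\<dots> \<le> y * (B' * B\<^sup>#)"
    by (rule mat_mult_left_mono[OF _ _ yc le y0]) (use Bc' b(1) in auto)
  also have "\<dots> = w * (A * B\<^sup>#)"
    using assoc_mult_mat[OF yc Bc' b(1)] assoc_mult_mat[OF w(1) Ac b(1)] yB by simp
  finally have wAB: "(1 - t) \<cdot>\<^sub>m w \<le> w * (A * B\<^sup>#)" .
  have "(1 - t) \<cdot>\<^sub>m w * ?S \<le> w * (A * B\<^sup>#) * ?S"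
    by (rule mat_mult_right_mono[where l = 1, OF _ _ Sc wAB S0]) (use w(1) AB in auto)
  also have "w * (A * B\<^sup>#) * ?S = w * (A * B\<^sup># * ?S)" by (rule assoc_mult_mat[OF w(1) AB Sc])
  \<comment> \<open>Here A B# = B B# - S, and the projection B B# fixes C from the left, hence also
    S = C B#.\<close>
  also have "A * B\<^sup># * ?S = ?S - ?S * ?S"
  proof -
    have "A * B\<^sup># = B * B\<^sup># - ?S"
      unfolding ABC by (rule minus_mult_distrib_mat) (use Bc Cc b(1) in auto)
    then have "A * B\<^sup># * ?S = B * B\<^sup># * ?S - ?S * ?S"
      using minus_mult_distrib_mat[of "B * B\<^sup>#" n n ?S ?S n] Bc b(1) Sc by simp
    also have "B * B\<^sup># * ?S = B * B\<^sup># * C * B\<^sup>#"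
      using assoc_mult_mat[of "B * B\<^sup>#" n n C n "B\<^sup>#" n] Bc b(1) Cc by simp
    finally show ?thesis using proper_splitting_projection(2)[OF sp B] by simp
  qed
  also have "w * (?S - ?S * ?S) = w * ?S - w * ?S * ?S"
    using mult_minus_distrib_mat[OF w(1) Sc, of "?S * ?S"] assoc_mult_mat[OF w(1) Sc Sc] Sc by simp
  finally have "w * ?S * ?S \<le> t \<cdot>\<^sub>m (w * ?S)"
    using w(1) Sc mult_smult_assoc_mat[OF w(1) Sc, of "1 - t"]
    by (auto simp: less_eq_mat_def algebra_simps simp del: index_mult_mat(1))
  moreover have "0 \<le> t" using rho_nonneg[OF Sc' n] t(1) by simp
  ultimately have "rho ?S \<le> t" using rho_le_of_positive_row[OF Sc n S0 w(1,2)] by blast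
  then show False using t(2) by simp
qed

section \<open>Transfer from H to S\<close>

text \<open>Both sides equal V - V U# V, since U U# fixes V from the left and U# U fixes it from the
  right.\<close>

lemma proper_splitting_intertwine:
  assumes sp: "proper_splitting n A U V" and U: "group_invertible U"
  shows "A * (U\<^sup># * V) = V * U\<^sup># * A"
proof -
  have Ac: "A \<in> carrier_mat n n" and Uc: "U \<in> carrier_mat n n" and Vc: "V \<in> carrier_mat n n"
    and AUV: "A = U - V"
    using sp unfolding proper_splitting_def by auto
  note u = group_inverse_facts[OF U Uc]
  have "A * (U\<^sup># * V) = U * (U\<^sup># * V) - V * (U\<^sup># * V)"
    unfolding AUV by (rule minus_mult_distrib_mat) (use Uc Vc u(1) in auto)
  also have "U * (U\<^sup># * V) = V * U\<^sup># * U"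
    using proper_splitting_projection[OF sp U] Uc Vc u(1)
    by (simp add: assoc_mult_mat[of _ n n _ n _ n])
  also have "V * (U\<^sup># * V) = V * U\<^sup># * V"
    using Vc u(1) by (simp add: assoc_mult_mat[of _ n n _ n _ n])
  also have "V * U\<^sup># * U - V * U\<^sup># * V = V * U\<^sup># * A"
    unfolding AUV by (rule mult_minus_distrib_mat[symmetric]) (use Uc Vc u(1) in auto)
  finally show ?thesis .
qed

text \<open>These identities allow A# A to be inserted in front of the leading X# of
  \<open>H\<close> and A A# to be deleted behind the trailing K# of \<open>S\<close>.\<close>

lemma proper_splitting_inverse_projection:
  assumes sp: "proper_splitting n A U V" and A: "group_invertible A" and U: "group_invertible U"
  shows "A\<^sup># * A * U\<^sup># = U\<^sup>#" and "U\<^sup># * (A * A\<^sup>#) = U\<^sup>#"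
proof -
  have Ac: "A \<in> carrier_mat n n" and Uc: "U \<in> carrier_mat n n"
    using sp unfolding proper_splitting_def by auto
  note a = group_inverse_facts[OF A Ac] and u = group_inverse_facts[OF U Uc]
  note P = proper_splitting_same_projection[OF sp A U]
  show "A\<^sup># * A * U\<^sup># = U\<^sup>#" using P u(3,4) a(4) by metis
  show "U\<^sup># * (A * A\<^sup>#) = U\<^sup>#"
    using u(3) assoc_mult_mat[OF u(1) Uc u(1)] P by simp
qed

theorem theorem3p19:
  fixes n :: nat
    and A K L U V X Y B C B12 C12 B13 C13 B23 C23 H S :: "real mat"
  assumes "n > 0"
    and "A \<in> carrier_mat n n"
    and "group_monotone A"
    and "proper_G_weak_regular_II n A K L"
    and "proper_G_weak_regular_II n A U V"
    and "proper_G_weak_regular_II n A X Y"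
    and "mat_range (K + X - A + Y * U\<^sup># * L) = mat_range A"
    and "mat_kernel (K + X - A + Y * U\<^sup># * L) = mat_kernel A"
    and "H = X\<^sup># * Y * U\<^sup># * V * K\<^sup># * L"
    and "S = Y * X\<^sup># * V * U\<^sup># * L * K\<^sup>#"
    and "proper_G_weak_regular_II n A B C"
    and "splitting_induced_by_right n A B C S"
    and "proper_G_weak_regular_II n A B12 C12"
    and "splitting_induced_by_iteration n A B12 C12 (U\<^sup># * V * K\<^sup># * L)"
    and "proper_G_weak_regular_II n A B13 C13"
    and "splitting_induced_by_iteration n A B13 C13 (X\<^sup># * Y * K\<^sup># * L)"
    and "proper_G_weak_regular_II n A B23 C23"
    and "splitting_induced_by_iteration n A B23 C23 (X\<^sup># * Y * U\<^sup># * V)"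
    and "1\<^sub>m n \<le> B12 * B\<^sup>#"
    and "1\<^sub>m n \<le> B13 * B\<^sup>#"
    and "1\<^sub>m n \<le> B23 * B\<^sup>#"
  shows "rho H \<le> Min {rho (K\<^sup># * L * U\<^sup># * V), rho (X\<^sup># * Y * K\<^sup># * L), rho (X\<^sup># * Y * U\<^sup># * V)}
    \<and> Min {rho (K\<^sup># * L * U\<^sup># * V), rho (X\<^sup># * Y * K\<^sup># * L), rho (X\<^sup># * Y * U\<^sup># * V)} < 1"
proof -
  note n = assms(1) and Ac = assms(2)
  have A: "group_invertible A" using assms(3) by (simp add: group_monotone_def)
  have spK: "proper_splitting n A K L" and K: "group_invertible K"
    and spU: "proper_splitting n A U V" and U: "group_invertible U"
    and spX: "proper_splitting n A X Y" and X: "group_invertible X"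
    using assms(4-6) unfolding proper_G_weak_regular_II_def by auto
  have Kc: "K \<in> carrier_mat n n" "L \<in> carrier_mat n n" "U \<in> carrier_mat n n"
    "V \<in> carrier_mat n n" "X \<in> carrier_mat n n" "Y \<in> carrier_mat n n"
    using spK spU spX unfolding proper_splitting_def by auto
  note gK = group_inverse_facts[OF K Kc(1)] and gU = group_inverse_facts[OF U Kc(3)]
    and gX = group_inverse_facts[OF X Kc(5)] and gA = group_inverse_facts[OF A Ac]
  note carr = Ac Kc gK(1) gU(1) gX(1) gA(1)
  note as = assoc_mult_mat[of _ n n _ n _ n]
  have Hc: "H \<in> carrier_mat n n" and Sc: "S \<in> carrier_mat n n"
    using carr by (auto simp: assms(9,10))
  have iK: "A * (K\<^sup># * L) = L * K\<^sup># * A" and iU: "A * (U\<^sup># * V) = V * U\<^sup># * A"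
    and iX: "A * (X\<^sup># * Y) = Y * X\<^sup># * A"
    using proper_splitting_intertwine spK K spU U spX X by blast+
  have AH: "A * H = S * A"
  proof -
    \<comment> \<open>The factor \<open>A\<close> is pushed to the right, turning X# Y, U# V and K#
      L one after the other into Y X#, V U# and L K#.\<close>
    have "A * H = A * (X\<^sup># * Y) * (U\<^sup># * V * (K\<^sup># * L))"
      unfolding assms(9) using carr by (simp add: as)
    also have "\<dots> = Y * X\<^sup># * (A * (U\<^sup># * V) * (K\<^sup># * L))"
      unfolding iX using carr by (simp add: as)
    also have "\<dots> = Y * X\<^sup># * (V * U\<^sup># * (A * (K\<^sup># * L)))"
      unfolding iU using carr by (simp add: as)
    also have "\<dots> = S * A"
      unfolding iK assms(10) using carr by (simp add: as)
    finally show ?thesis .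
  qed
  \<comment> \<open>Since A# A fixes X# from the left, it fixes \<open>H\<close>, which gives H = A#
    (A H) = A# S A.\<close>
  have "H = A\<^sup># * A * X\<^sup># * (Y * U\<^sup># * V * K\<^sup># * L)"
    unfolding assms(9) proper_splitting_inverse_projection(1)[OF spX A X]
    using carr by (simp add: as)
  also have "\<dots> = A\<^sup># * (A * H)"
    unfolding assms(9) using carr by (simp add: as)
  also have "\<dots> = A\<^sup># * (S * A)" unfolding AH ..
  finally have "rho H = rho (A\<^sup># * (S * A))" by simp
  \<comment> \<open>Cyclic invariance moves A# to the right end, where A A# is absorbed by the
    trailing K# of \<open>S\<close>.\<close>
  also have "\<dots> = rho (S * A * A\<^sup>#)"
    by (rule rho_mult_commute[OF gA(1) _ n]) (use Sc Ac in auto)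
  also have "S * A * A\<^sup># = Y * X\<^sup># * V * U\<^sup># * L * (K\<^sup># * (A * A\<^sup>#))"
    unfolding assms(10) using carr by (simp add: as)
  also have "\<dots> = S"
    unfolding assms(10) proper_splitting_inverse_projection(2)[OF spK A K] ..
  finally have HS: "rho H = rho S" .
  have CB: "C * B\<^sup># = S" using assms(12) by (simp add: splitting_induced_by_right_def)
  \<comment> \<open>One argument serves the three two-term splittings: T = B'# C' and C' B'# have
    the same spectral radius, so the type II bounds for C' B'# hold for \<open>T\<close>.\<close>
  have main: "rho H \<le> rho T \<and> rho T < 1"
    if s': "proper_G_weak_regular_II n A B' C'"
      and T: "splitting_induced_by_iteration n A B' C' T" and le: "1\<^sub>m n \<le> B' * B\<^sup>#" for B' C' T
  proof -
    have c: "B' \<in> carrier_mat n n" "C' \<in> carrier_mat n n" and "group_invertible B'"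
      and T': "T = B'\<^sup># * C'"
      using T unfolding splitting_induced_by_iteration_def proper_splitting_def by auto
    then have "rho T = rho (C' * B'\<^sup>#)"
      using rho_mult_commute[OF _ c(2) n] group_inverse_facts(1) by blast
    then show ?thesis
      using type_II_rho_less_1[OF n assms(3) s']
        type_II_rho_comparison[OF n assms(11) s' le] HS CB by simp
  qed
  \<comment> \<open>The matrix inducing \<open>B12\<close> has the factors K# L and U# V in the
    opposite order; cyclic invariance identifies the two spectral radii.\<close>
  have "rho (K\<^sup># * L * U\<^sup># * V) = rho (K\<^sup># * L * (U\<^sup># * V))" using carr by (simp add: as)
  also have "\<dots> = rho (U\<^sup># * V * (K\<^sup># * L))"
    by (rule rho_mult_commute[OF _ _ n]) (use carr in auto)
  also have "\<dots> = rho (U\<^sup># * V * K\<^sup># * L)" using carr by (simp add: as)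
  finally show ?thesis
    using main[OF assms(13,14,19)] main[OF assms(15,16,20)] main[OF assms(17,18,21)] by (simp add: min_less_iff_disj)
qed

end
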